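(* Let $(\Omega,\mathcal F,P)$ be a nonatomic probability space, $E=L^0(\mathcal F,\mathbb R)$ endowed with the locally $L^0$-convex topology $\mathcal T_c$ induced by $|\cdot|$, and $$M=\{x\in E:\ \text{there exists a positive real number } m_x \text{ such that } x>m_x \text{ a.s. on }\Omega\}.$$ Then $M$ is $L^0$-convex, $\mathcal T_c$-closed and $\mathcal T_c$-open.
   Context: $L^0(\mathcal F,\mathbb R)$ is the algebra of (a.s.-equality) equivalence classes of real-valued $\mathcal F$-measurable random variables with the a.s. order; $L^0_{++}(\mathcal F)$ is the set of its elements that are $>0$ a.s. on $\Omega$. Nonatomic means $\mathcal F$ contains no $P$-atoms. A set $G\subset E$ is $\mathcal T_c$-open if for each $x\in G$ there is $\varepsilon\in L^0_{++}(\mathcal F)$ with $\{y\in E:|y-x|\le\varepsilon\}\subset G$. A set $G$ is $L^0$-convex if $\xi x+(1-\xi)y\in G$ for all $x,y\in G$ and all $\xi\in L^0(\mathcal F,\mathbb R)$ with $0\le\xi\le1$. *)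

theory Defs
  imports "HOL-Probability.Probability"
begin

definition P_atom :: "'a measure \<Rightarrow> 'a set \<Rightarrow> bool" where
  "P_atom P A \<longleftrightarrow> A \<in> sets P \<and> measure P A > 0 \<and>
     (\<forall>B\<in>sets P. B \<subseteq> A \<longrightarrow> measure P B = 0 \<or> measure P (A - B) = 0)"

definition nonatomic :: "'a measure \<Rightarrow> bool" where
  "nonatomic P \<longleftrightarrow> \<not> (\<exists>A. P_atom P A)"

text \<open>
  Elements of \<open>L\<^sup>0\<close> are equivalence classes, represented as sets of measurable functions, so
  that equality of elements is HOL equality. Operations and relations are lifted through
  representatives in the style of \<^theory>\<open>HOL.Equiv_Relations\<close>; the lemmas ending in
  \<open>_class\<close> state that the lifted notions do not depend on the representatives.
\<close>

definition ae_rel :: "'a measure \<Rightarrow> (('a \<Rightarrow> real) \<times> ('a \<Rightarrow> real)) set" where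
  "ae_rel P = {(f, g). f \<in> borel_measurable P \<and> g \<in> borel_measurable P \<and> (AE \<omega> in P. f \<omega> = g \<omega>)}"

definition L0 :: "'a measure \<Rightarrow> ('a \<Rightarrow> real) set set" where
  "L0 P = borel_measurable P // ae_rel P"

definition L0_class :: "'a measure \<Rightarrow> ('a \<Rightarrow> real) \<Rightarrow> ('a \<Rightarrow> real) set" where
  "L0_class P f = ae_rel P `` {f}"

definition L0_const :: "'a measure \<Rightarrow> real \<Rightarrow> ('a \<Rightarrow> real) set" where
  "L0_const P c = L0_class P (\<lambda>\<omega>. c)"

definition L0_lift1 ::
  "'a measure \<Rightarrow> (real \<Rightarrow> real) \<Rightarrow> ('a \<Rightarrow> real) set \<Rightarrow> ('a \<Rightarrow> real) set" where
  "L0_lift1 P h X = (\<Union>f\<in>X. L0_class P (\<lambda>\<omega>. h (f \<omega>)))"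

definition L0_lift2 ::
  "'a measure \<Rightarrow> (real \<Rightarrow> real \<Rightarrow> real) \<Rightarrow> ('a \<Rightarrow> real) set \<Rightarrow> ('a \<Rightarrow> real) set \<Rightarrow> ('a \<Rightarrow> real) set" where
  "L0_lift2 P h X Y = (\<Union>f\<in>X. \<Union>g\<in>Y. L0_class P (\<lambda>\<omega>. h (f \<omega>) (g \<omega>)))"

definition L0_rel ::
  "'a measure \<Rightarrow> (real \<Rightarrow> real \<Rightarrow> bool) \<Rightarrow> ('a \<Rightarrow> real) set \<Rightarrow> ('a \<Rightarrow> real) set \<Rightarrow> bool" where
  "L0_rel P R X Y \<longleftrightarrow> (\<exists>f\<in>X. \<exists>g\<in>Y. AE \<omega> in P. R (f \<omega>) (g \<omega>))"

definition L0_add where "L0_add P = L0_lift2 P (+)"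
definition L0_diff where "L0_diff P = L0_lift2 P (-)"
definition L0_mult where "L0_mult P = L0_lift2 P (*)"
definition L0_abs where "L0_abs P = L0_lift1 P abs"
definition L0_le where "L0_le P = L0_rel P (\<le>)"

text \<open>
  \<open>L0_less\<close> is strict inequality a.s. on the whole space, which is stronger than the strict part
  (\<open>\<le>\<close> and \<open>\<noteq>\<close>) of the a.s. order.
\<close>

definition L0_less where "L0_less P = L0_rel P (<)"

definition L0_pp :: "'a measure \<Rightarrow> ('a \<Rightarrow> real) set set" where
  "L0_pp P = {e \<in> L0 P. L0_less P (L0_const P 0) e}"

definition L0_cball ::
  "'a measure \<Rightarrow> ('a \<Rightarrow> real) set \<Rightarrow> ('a \<Rightarrow> real) set \<Rightarrow> ('a \<Rightarrow> real) set set" where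
  "L0_cball P x e = {y \<in> L0 P. L0_le P (L0_abs P (L0_diff P y x)) e}"

definition Tc_open :: "'a measure \<Rightarrow> ('a \<Rightarrow> real) set set \<Rightarrow> bool" where
  "Tc_open P G \<longleftrightarrow> G \<subseteq> L0 P \<and> (\<forall>x\<in>G. \<exists>e\<in>L0_pp P. L0_cball P x e \<subseteq> G)"

definition Tc :: "'a measure \<Rightarrow> ('a \<Rightarrow> real) set topology" where
  "Tc P = topology (Tc_open P)"

definition L0_convex :: "'a measure \<Rightarrow> ('a \<Rightarrow> real) set set \<Rightarrow> bool" where
  "L0_convex P G \<longleftrightarrow> G \<subseteq> L0 P \<and>
     (\<forall>x\<in>G. \<forall>y\<in>G. \<forall>\<xi>\<in>L0 P. L0_le P (L0_const P 0) \<xi> \<and> L0_le P \<xi> (L0_const P 1) \<longrightarrow>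
        L0_add P (L0_mult P \<xi> x) (L0_mult P (L0_diff P (L0_const P 1) \<xi>) y) \<in> G)"

definition M_set :: "'a measure \<Rightarrow> ('a \<Rightarrow> real) set set" where
  "M_set P = {x \<in> L0 P. \<exists>m::real. m > 0 \<and> L0_less P (L0_const P m) x}"

lemma equiv_ae_rel: "equiv (borel_measurable P) (ae_rel P)"
proof (rule equivI)
  show "ae_rel P \<subseteq> borel_measurable P \<times> borel_measurable P"
    by (auto simp: ae_rel_def)
  show "refl_on (borel_measurable P) (ae_rel P)"
    by (auto simp: ae_rel_def refl_on_def)
  show "sym (ae_rel P)"
    by (auto simp: ae_rel_def sym_def elim: eventually_mono)
  show "trans (ae_rel P)"
    by (auto simp: ae_rel_def trans_def elim: eventually_elim2)
qed

lemma mem_L0_class: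
  "f \<in> borel_measurable P \<Longrightarrow>
     g \<in> L0_class P f \<longleftrightarrow> g \<in> borel_measurable P \<and> (AE \<omega> in P. f \<omega> = g \<omega>)"
  by (auto simp: L0_class_def ae_rel_def)

lemma L0_class_self: "f \<in> borel_measurable P \<Longrightarrow> f \<in> L0_class P f"
  by (simp add: mem_L0_class)

lemma L0_class_in_L0: "f \<in> borel_measurable P \<Longrightarrow> L0_class P f \<in> L0 P"
  by (auto simp: L0_def L0_class_def quotient_def)

lemma L0_cases:
  assumes "x \<in> L0 P"
  obtains f where "f \<in> borel_measurable P" "x = L0_class P f"
  using assms by (auto simp: L0_def L0_class_def quotient_def)

lemma L0_class_eq_iff:
  assumes "f \<in> borel_measurable P" "g \<in> borel_measurable P"
  shows "L0_class P f = L0_class P g \<longleftrightarrow> (AE \<omega> in P. f \<omega> = g \<omega>)"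
  using eq_equiv_class_iff[OF equiv_ae_rel assms] assms
  by (simp add: L0_class_def ae_rel_def)

lemma L0_lift1_class:
  assumes h: "h \<in> borel_measurable borel" and f: "f \<in> borel_measurable P"
  shows "L0_lift1 P h (L0_class P f) = L0_class P (\<lambda>\<omega>. h (f \<omega>))"
proof -
  have "L0_class P (\<lambda>\<omega>. h (f' \<omega>)) = L0_class P (\<lambda>\<omega>. h (f \<omega>))" if "f' \<in> L0_class P f" for f'
  proof -
    have [measurable]: "f' \<in> borel_measurable P" "f \<in> borel_measurable P" "h \<in> borel_measurable borel"
      and "AE \<omega> in P. f \<omega> = f' \<omega>"
      using that h f by (auto simp: mem_L0_class)
    then show ?thesis
      by (subst L0_class_eq_iff) (auto elim: eventually_mono)
  qed
  then show ?thesis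
    using L0_class_self[OF f] unfolding L0_lift1_def by blast
qed

lemma L0_lift2_class:
  assumes h: "case_prod h \<in> borel_measurable (borel \<Otimes>\<^sub>M borel)"
    and f: "f \<in> borel_measurable P" and g: "g \<in> borel_measurable P"
  shows "L0_lift2 P h (L0_class P f) (L0_class P g) = L0_class P (\<lambda>\<omega>. h (f \<omega>) (g \<omega>))"
proof -
  have "L0_class P (\<lambda>\<omega>. h (f' \<omega>) (g' \<omega>)) = L0_class P (\<lambda>\<omega>. h (f \<omega>) (g \<omega>))"
    if "f' \<in> L0_class P f" "g' \<in> L0_class P g" for f' g'
  proof -
    have m: "f' \<in> borel_measurable P" "g' \<in> borel_measurable P"
      and ae: "AE \<omega> in P. f \<omega> = f' \<omega>" "AE \<omega> in P. g \<omega> = g' \<omega>"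
      using that f g by (auto simp: mem_L0_class)
    have hm: "(\<lambda>\<omega>. h (u \<omega>) (v \<omega>)) \<in> borel_measurable P"
      if "u \<in> borel_measurable P" "v \<in> borel_measurable P" for u v
      using measurable_compose[OF measurable_Pair[OF that] h] by simp
    show ?thesis
      unfolding L0_class_eq_iff[OF hm[OF m] hm[OF f g]] using ae by eventually_elim simp
  qed
  then show ?thesis
    using L0_class_self[OF f] L0_class_self[OF g] unfolding L0_lift2_def by blast
qed

lemma L0_rel_class:
  assumes f: "f \<in> borel_measurable P" and g: "g \<in> borel_measurable P"
  shows "L0_rel P R (L0_class P f) (L0_class P g) \<longleftrightarrow> (AE \<omega> in P. R (f \<omega>) (g \<omega>))"
proof
  assume "L0_rel P R (L0_class P f) (L0_class P g)"
  then obtain f' g' where "AE \<omega> in P. f \<omega> = f' \<omega>" "AE \<omega> in P. g \<omega> = g' \<omega>"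
    "AE \<omega> in P. R (f' \<omega>) (g' \<omega>)"
    using f g by (auto simp: L0_rel_def mem_L0_class)
  then show "AE \<omega> in P. R (f \<omega>) (g \<omega>)"
    by eventually_elim simp
next
  assume "AE \<omega> in P. R (f \<omega>) (g \<omega>)"
  then show "L0_rel P R (L0_class P f) (L0_class P g)"
    using L0_class_self[OF f] L0_class_self[OF g] by (auto simp: L0_rel_def)
qed

lemma L0_add_class:
  "f \<in> borel_measurable P \<Longrightarrow> g \<in> borel_measurable P \<Longrightarrow>
     L0_add P (L0_class P f) (L0_class P g) = L0_class P (\<lambda>\<omega>. f \<omega> + g \<omega>)"
  unfolding L0_add_def by (rule L0_lift2_class) simp_all

lemma L0_diff_class:
  "f \<in> borel_measurable P \<Longrightarrow> g \<in> borel_measurable P \<Longrightarrow>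
     L0_diff P (L0_class P f) (L0_class P g) = L0_class P (\<lambda>\<omega>. f \<omega> - g \<omega>)"
  unfolding L0_diff_def by (rule L0_lift2_class) simp_all

lemma L0_mult_class:
  "f \<in> borel_measurable P \<Longrightarrow> g \<in> borel_measurable P \<Longrightarrow>
     L0_mult P (L0_class P f) (L0_class P g) = L0_class P (\<lambda>\<omega>. f \<omega> * g \<omega>)"
  unfolding L0_mult_def by (rule L0_lift2_class) simp_all

lemma L0_abs_class:
  "f \<in> borel_measurable P \<Longrightarrow> L0_abs P (L0_class P f) = L0_class P (\<lambda>\<omega>. \<bar>f \<omega>\<bar>)"
  unfolding L0_abs_def by (rule L0_lift1_class) simp_all

lemma L0_le_class:
  "f \<in> borel_measurable P \<Longrightarrow> g \<in> borel_measurable P \<Longrightarrow>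
     L0_le P (L0_class P f) (L0_class P g) \<longleftrightarrow> (AE \<omega> in P. f \<omega> \<le> g \<omega>)"
  unfolding L0_le_def by (rule L0_rel_class)

lemma L0_less_class:
  "f \<in> borel_measurable P \<Longrightarrow> g \<in> borel_measurable P \<Longrightarrow>
     L0_less P (L0_class P f) (L0_class P g) \<longleftrightarrow> (AE \<omega> in P. f \<omega> < g \<omega>)"
  unfolding L0_less_def by (rule L0_rel_class)

lemma L0_cball_class:
  assumes "f \<in> borel_measurable P" "g \<in> borel_measurable P" "e \<in> borel_measurable P"
  shows "L0_class P g \<in> L0_cball P (L0_class P f) (L0_class P e) \<longleftrightarrow>
    (AE \<omega> in P. \<bar>g \<omega> - f \<omega>\<bar> \<le> e \<omega>)"
  using assms by (simp add: L0_cball_def L0_class_in_L0 L0_diff_class L0_abs_class L0_le_class)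

lemma L0_pp_class:
  "e \<in> borel_measurable P \<Longrightarrow> L0_class P e \<in> L0_pp P \<longleftrightarrow> (AE \<omega> in P. 0 < e \<omega>)"
  by (simp add: L0_pp_def L0_const_def L0_class_in_L0 L0_less_class)

lemma L0_pp_inf:
  assumes "d \<in> L0_pp P" "e \<in> L0_pp P" "x \<in> L0 P"
  obtains c where "c \<in> L0_pp P" "L0_cball P x c \<subseteq> L0_cball P x d \<inter> L0_cball P x e"
proof -
  from assms obtain df ef f where
    m: "df \<in> borel_measurable P" "ef \<in> borel_measurable P" "f \<in> borel_measurable P"
    and eq: "d = L0_class P df" "e = L0_class P ef" "x = L0_class P f"
    unfolding L0_pp_def by (metis (no_types, lifting) L0_cases mem_Collect_eq)
  let ?c = "\<lambda>\<omega>. min (df \<omega>) (ef \<omega>)"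
  have mc: "?c \<in> borel_measurable P"
    using m by simp
  have pos: "AE \<omega> in P. 0 < df \<omega>" "AE \<omega> in P. 0 < ef \<omega>"
    using assms m by (simp_all add: eq L0_pp_class)
  have "L0_class P ?c \<in> L0_pp P"
    unfolding L0_pp_class[OF mc] using pos by eventually_elim simp
  moreover have "L0_cball P x (L0_class P ?c) \<subseteq> L0_cball P x d \<inter> L0_cball P x e"
  proof
    fix y assume y: "y \<in> L0_cball P x (L0_class P ?c)"
    then obtain g where g: "g \<in> borel_measurable P" "y = L0_class P g"
      by (auto simp: L0_cball_def elim: L0_cases)
    from y show "y \<in> L0_cball P x d \<inter> L0_cball P x e"
      unfolding eq g(2) Int_iff L0_cball_class[OF m(3) g(1) mc] L0_cball_class[OF m(3) g(1) m(1)]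
        L0_cball_class[OF m(3) g(1) m(2)]
      by simp
  qed
  ultimately show ?thesis
    using that by blast
qed

lemma istopology_Tc_open: "istopology (Tc_open P)"
  unfolding istopology_def
proof (intro conjI allI impI)
  fix S T assume ST: "Tc_open P S" "Tc_open P T"
  show "Tc_open P (S \<inter> T)"
    unfolding Tc_open_def
  proof (intro conjI ballI)
    show "S \<inter> T \<subseteq> L0 P"
      using ST by (auto simp: Tc_open_def)
    fix x assume x: "x \<in> S \<inter> T"
    with ST obtain d e where de: "d \<in> L0_pp P" "L0_cball P x d \<subseteq> S"
      "e \<in> L0_pp P" "L0_cball P x e \<subseteq> T"
      unfolding Tc_open_def by (meson IntE)
    moreover have "x \<in> L0 P"
      using ST x by (auto simp: Tc_open_def)
    ultimately obtain c where "c \<in> L0_pp P" "L0_cball P x c \<subseteq> L0_cball P x d \<inter> L0_cball P x e"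
      using L0_pp_inf by metis
    with de show "\<exists>e\<in>L0_pp P. L0_cball P x e \<subseteq> S \<inter> T"
      by blast
  qed
next
  fix \<K> assume "\<forall>K\<in>\<K>. Tc_open P K"
  then show "Tc_open P (\<Union>\<K>)"
    unfolding Tc_open_def by (meson Sup_least Union_iff Union_upper subset_trans)
qed

lemma openin_Tc: "openin (Tc P) G \<longleftrightarrow> Tc_open P G"
  by (simp add: Tc_def istopology_Tc_open)

lemma topspace_Tc: "topspace (Tc P) = L0 P"
proof
  show "topspace (Tc P) \<subseteq> L0 P"
    using openin_topspace[of "Tc P"] unfolding openin_Tc by (simp add: Tc_open_def)
  have "L0_const P 1 \<in> L0_pp P"
    by (simp add: L0_const_def L0_pp_class)
  then have "Tc_open P (L0 P)"
    by (auto simp: Tc_open_def L0_cball_def)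
  then show "L0 P \<subseteq> topspace (Tc P)"
    by (simp add: openin_subset flip: openin_Tc)
qed

end

(* Openness: if x > m, then the ball of constant radius m/2 around x stays in M.
   Closedness: for x outside M take the radius |x|/2 where x is nonzero. If y > m lies in the ball,
   then x >= 2m/3 wherever x is nonzero, so x itself would be in M unless {x = 0} has positive
   measure. On that set the radius is chosen positive but with essential infimum 0, which is
   possible because P is nonatomic; then no y in the ball is bounded away from 0 there. *)

theory Submission
  imports Defs
begin

text \<open>Since \<open>A\<close> is not an atom, it splits into two measurable pieces of positive
  measure. The two measures add up to that of \<open>A\<close>, so one piece has at most half of
  it.\<close>

lemma nonatomic_halving:
  assumes "finite_measure P" "nonatomic P" and A: "A \<in> sets P" "measure P A > 0"
  obtains B where "B \<in> sets P" "B \<subseteq> A" "measure P B > 0" "measure P B \<le> measure P A / 2"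
proof -
  interpret finite_measure P by fact
  have "\<not> P_atom P A"
    using assms(2) by (auto simp: nonatomic_def)
  with A obtain B where B: "B \<in> sets P" "B \<subseteq> A" "measure P B \<noteq> 0" "measure P (A - B) \<noteq> 0"
    by (auto simp: P_atom_def)
  have pos: "measure P B > 0" "measure P (A - B) > 0"
    using B by (simp_all add: zero_less_measure_iff)
  have "measure P (A - B) = measure P A - measure P B"
    using A B by (simp add: finite_measure_Diff)
  then consider "measure P B \<le> measure P A / 2" | "measure P (A - B) \<le> measure P A / 2"
    by linarith
  then show ?thesis
    using that[of B] that[of "A - B"] A B pos by cases auto
qed

text \<open>Halving is iterated by dependent choice; the measures are then dominated by a geometric
  sequence of ratio 1/2.\<close>

lemma nonatomic_vanishing_subsets:
  assumes "finite_measure P" "nonatomic P" and A: "A \<in> sets P" "measure P A > 0"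
  obtains B :: "nat \<Rightarrow> 'a set" where "decseq B" "\<And>n. B n \<in> sets P" "\<And>n. B n \<subseteq> A"
    "\<And>n. measure P (B n) > 0" "(\<lambda>n. measure P (B n)) \<longlonglongrightarrow> 0"
proof -
  \<comment> \<open>The first bracket is the invariant of every chosen set, the second the relation
    between consecutive ones, as \<open>dependent_nat_choice\<close> expects.\<close>
  have "\<exists>B. \<forall>n. (B n \<in> sets P \<and> B n \<subseteq> A \<and> measure P (B n) > 0) \<and>
      (B (Suc n) \<subseteq> B n \<and> measure P (B (Suc n)) \<le> measure P (B n) / 2)"
  proof (rule dependent_nat_choice)
    show "\<exists>B. B \<in> sets P \<and> B \<subseteq> A \<and> measure P B > 0"
      using A by blast
    fix B assume "B \<in> sets P \<and> B \<subseteq> A \<and> measure P B > 0"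
    then obtain C where "C \<in> sets P" "C \<subseteq> B" "measure P C > 0" "measure P C \<le> measure P B / 2" "B \<subseteq> A"
      by (elim conjE nonatomic_halving[OF assms(1,2), of B])
    then show "\<exists>C. (C \<in> sets P \<and> C \<subseteq> A \<and> measure P C > 0) \<and>
        (C \<subseteq> B \<and> measure P C \<le> measure P B / 2)"
      by (intro exI[of _ C] conjI order_trans[of C B A])
  qed
  then obtain B where B: "\<And>n. B n \<in> sets P" "\<And>n. B n \<subseteq> A" "\<And>n. measure P (B n) > 0"
    "\<And>n. B (Suc n) \<subseteq> B n" "\<And>n. measure P (B (Suc n)) \<le> measure P (B n) / 2"
    by blast
  have bound: "measure P (B n) \<le> measure P (B 0) * (1/2) ^ n" for n
  proof (induction n)
    case (Suc n)
    then show ?case using B(5)[of n] by simp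
  qed simp
  have "(\<lambda>n. measure P (B 0) * (1/2) ^ n) \<longlonglongrightarrow> 0"
    by (intro tendsto_mult_right_zero LIMSEQ_realpow_zero) auto
  then have "(\<lambda>n. measure P (B n)) \<longlonglongrightarrow> 0"
    by (rule tendsto_sandwich[OF _ _ tendsto_const, rotated 2]) (auto simp: bound)
  with B show ?thesis
    by (intro that[of B] decseq_SucI)
qed

text \<open>This supplies the radius on the zero set in the closedness proof. The function is at
  most 1/(n+1) almost everywhere on the n-th of a chain of shrinking subsets of positive measure, so
  no constant m > 0 bounds it from below on a non-null \<open>A\<close>. Concluding that
  \<open>A\<close> is null, rather than a contradiction, lets the statement cover null sets as
  well.\<close>

lemma nonatomic_positive_not_bounded_below:
  assumes "finite_measure P" "nonatomic P" and A: "A \<in> sets P"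
  obtains h :: "'a \<Rightarrow> real" where "h \<in> borel_measurable P" "\<And>\<omega>. 0 < h \<omega>"
    "\<And>m. 0 < m \<Longrightarrow> AE \<omega> in P. \<omega> \<in> A \<longrightarrow> m \<le> h \<omega> \<Longrightarrow> AE \<omega> in P. \<omega> \<notin> A"
proof (cases "measure P A = 0")
  case True
  interpret finite_measure P by fact
  have "AE \<omega> in P. \<omega> \<notin> A"
    using True A by (intro AE_not_in) (simp add: null_sets_def emeasure_eq_measure)
  then show ?thesis
    by (intro that[of "\<lambda>_. 1"]) auto
next
  case False
  interpret finite_measure P by fact
  obtain B :: "nat \<Rightarrow> 'a set" where B: "decseq B" and [measurable]: "\<And>n. B n \<in> sets P"
    and sub: "\<And>n. B n \<subseteq> A" and pos: "\<And>n. measure P (B n) > 0"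
    and lim: "(\<lambda>n. measure P (B n)) \<longlonglongrightarrow> 0"
    using nonatomic_vanishing_subsets[OF assms] False zero_less_measure_iff by blast
  \<comment> \<open>The \<open>LEAST\<close> is the index at which a point leaves the chain; deeper
    points leave later and get smaller values. On the intersection of all \<open>B n\<close> it is
    an unspecified natural number, which keeps \<open>h\<close> positive and does no harm because
    the intersection is null.\<close>
  define h where "h \<omega> = 1 / (1 + real (LEAST n. \<omega> \<notin> B n))" for \<omega>
  have "h \<in> borel_measurable P"
    unfolding h_def by measurable
  moreover have "0 < h \<omega>" for \<omega>
    by (simp add: h_def add_pos_nonneg)
  moreover have "AE \<omega> in P. \<omega> \<notin> A" if "0 < m" and ae: "AE \<omega> in P. \<omega> \<in> A \<longrightarrow> m \<le> h \<omega>" for m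
  proof -
    have "(\<lambda>n. measure P (B n)) \<longlonglongrightarrow> measure P (\<Inter>n. B n)"
      using B by (intro finite_Lim_measure_decseq) auto
    then have "measure P (\<Inter>n. B n) = 0"
      using lim LIMSEQ_unique by blast
    then have inter: "AE \<omega> in P. \<omega> \<notin> (\<Inter>n. B n)"
      by (intro AE_not_in) (simp add: null_sets_def emeasure_eq_measure)
    \<comment> \<open>For this n, almost every point of \<open>B n\<close> has \<open>h\<close>
      below m, while the assumption gives m \<le> \<open>h\<close> on \<open>A\<close>. Hence
      \<open>B n\<close> must be null.\<close>
    obtain n where n: "1 / real (Suc n) < m"
      using \<open>0 < m\<close> nat_approx_posE by blast
    have "AE \<omega> in P. \<omega> \<notin> B n"
      using ae inter
    proof eventually_elim
      case (elim \<omega>)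
      show ?case
      proof
        assume \<omega>: "\<omega> \<in> B n"
        have "\<omega> \<notin> B (LEAST n. \<omega> \<notin> B n)"
          using elim(2) by (intro LeastI_ex[of "\<lambda>n. \<omega> \<notin> B n"]) simp
        \<comment> \<open>An exit index below n is impossible: the chain decreases, so
          \<open>B n\<close> lies inside every earlier set.\<close>
        then have "n \<le> (LEAST n. \<omega> \<notin> B n)"
          using \<omega> decseqD[OF B] by (metis nle_le subsetD)
        then have "h \<omega> \<le> 1 / real (Suc n)"
          by (simp add: h_def frac_le)
        then show False
          using n elim(1) \<omega> sub by fastforce
      qed
    qed
    then have "measure P (B n) = 0"
      by (simp add: AE_iff_null_sets[symmetric] measure_eq_0_null_sets)
    \<comment> \<open>The goal follows from the contradiction with the positive measure of
      \<open>B n\<close>.\<close>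
    then show ?thesis
      using pos[of n] by simp
  qed
  ultimately show ?thesis
    using that by blast
qed

lemma L0_class_mem_M_set:
  assumes "f \<in> borel_measurable P"
  shows "L0_class P f \<in> M_set P \<longleftrightarrow> (\<exists>m>0. AE \<omega> in P. m < f \<omega>)"
  using assms by (simp add: M_set_def L0_const_def L0_class_in_L0 L0_less_class)

lemma M_set_subset_L0: "M_set P \<subseteq> L0 P"
  by (auto simp: M_set_def)

text \<open>Reduces openness to almost-everywhere statements about representing functions, so that
  later arguments need no quotient operations.\<close>

lemma Tc_openI:
  assumes "G \<subseteq> L0 P"
    and "\<And>f. f \<in> borel_measurable P \<Longrightarrow> L0_class P f \<in> G \<Longrightarrow>
      \<exists>e\<in>borel_measurable P. (AE \<omega> in P. 0 < e \<omega>) \<and>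
        (\<forall>g\<in>borel_measurable P. (AE \<omega> in P. \<bar>g \<omega> - f \<omega>\<bar> \<le> e \<omega>) \<longrightarrow> L0_class P g \<in> G)"
  shows "Tc_open P G"
  unfolding Tc_open_def
proof (intro conjI ballI)
  fix x assume "x \<in> G"
  moreover from this obtain f where f: "f \<in> borel_measurable P" "x = L0_class P f"
    using assms(1) by (blast elim: L0_cases)
  ultimately obtain e where e: "e \<in> borel_measurable P" "AE \<omega> in P. 0 < e \<omega>"
    "\<And>g. g \<in> borel_measurable P \<Longrightarrow> AE \<omega> in P. \<bar>g \<omega> - f \<omega>\<bar> \<le> e \<omega> \<Longrightarrow> L0_class P g \<in> G"
    using assms(2)[of f] by blast
  have "L0_cball P x (L0_class P e) \<subseteq> G"
  proof
    fix y assume y: "y \<in> L0_cball P x (L0_class P e)"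
    then obtain g where g: "g \<in> borel_measurable P" "y = L0_class P g"
      by (auto simp: L0_cball_def elim: L0_cases)
    with y show "y \<in> G"
      using e f by (simp add: L0_cball_class)
  qed
  moreover have "L0_class P e \<in> L0_pp P"
    using e by (simp add: L0_pp_class)
  ultimately show "\<exists>e\<in>L0_pp P. L0_cball P x e \<subseteq> G"
    by blast
qed fact

lemma L0_convex_M_set: "L0_convex P (M_set P)"
  unfolding L0_convex_def
proof (intro conjI ballI impI M_set_subset_L0)
  fix x y \<xi>
  assume M: "x \<in> M_set P" "y \<in> M_set P" and "\<xi> \<in> L0 P"
    and le: "L0_le P (L0_const P 0) \<xi> \<and> L0_le P \<xi> (L0_const P 1)"
  from M(1) M_set_subset_L0 obtain f where [measurable]: "f \<in> borel_measurable P"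
    and x: "x = L0_class P f"
    by (blast elim: L0_cases)
  from M(2) M_set_subset_L0 obtain g where [measurable]: "g \<in> borel_measurable P"
    and y: "y = L0_class P g"
    by (blast elim: L0_cases)
  from \<open>\<xi> \<in> L0 P\<close> obtain t where [measurable]: "t \<in> borel_measurable P"
    and \<xi>: "\<xi> = L0_class P t"
    by (blast elim: L0_cases)
  note eq = x y \<xi>
  obtain a b where ab: "0 < a" "AE \<omega> in P. a < f \<omega>" "0 < b" "AE \<omega> in P. b < g \<omega>"
    using M by (auto simp: eq L0_class_mem_M_set)
  have t: "AE \<omega> in P. 0 \<le> t \<omega>" "AE \<omega> in P. t \<omega> \<le> 1"
    using le by (simp_all add: eq L0_const_def L0_le_class)
  \<comment> \<open>The smaller of the two lower bounds survives every pointwise convex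
    combination.\<close>
  have "AE \<omega> in P. min a b < t \<omega> * f \<omega> + (1 - t \<omega>) * g \<omega>"
    using ab(2,4) t
  proof eventually_elim
    case (elim \<omega>)
    \<comment> \<open>\<open>convex_bound_lt\<close> concerns upper bounds, hence the negated
      values.\<close>
    then have "t \<omega> * - f \<omega> + (1 - t \<omega>) * - g \<omega> < - min a b"
      by (intro convex_bound_lt) (auto simp: min_def)
    then show ?case
      by linarith
  qed
  then show "L0_add P (L0_mult P \<xi> x) (L0_mult P (L0_diff P (L0_const P 1) \<xi>) y) \<in> M_set P"
    using ab(1,3) by (auto simp: eq L0_const_def L0_mult_class L0_diff_class L0_add_class
        L0_class_mem_M_set intro!: exI[of _ "min a b"])
qed

lemma openin_M_set: "openin (Tc P) (M_set P)"
  unfolding openin_Tc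
proof (rule Tc_openI[OF M_set_subset_L0])
  fix f assume "f \<in> borel_measurable P" "L0_class P f \<in> M_set P"
  then obtain m where m: "0 < m" "AE \<omega> in P. m < f \<omega>"
    by (auto simp: L0_class_mem_M_set)
  have "L0_class P g \<in> M_set P"
    if "g \<in> borel_measurable P" and ae: "AE \<omega> in P. \<bar>g \<omega> - f \<omega>\<bar> \<le> m / 2" for g
  proof -
    have "AE \<omega> in P. m / 2 < g \<omega>"
      using m(2) ae by eventually_elim linarith
    then show ?thesis
      unfolding L0_class_mem_M_set[OF that(1)] using m(1) by (intro exI[of _ "m / 2"]) simp
  qed
  then show "\<exists>e\<in>borel_measurable P. (AE \<omega> in P. 0 < e \<omega>) \<and>
      (\<forall>g\<in>borel_measurable P. (AE \<omega> in P. \<bar>g \<omega> - f \<omega>\<bar> \<le> e \<omega>) \<longrightarrow> L0_class P g \<in> M_set P)"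
    using m(1) by (intro bexI[of _ "\<lambda>_. m / 2"]) auto
qed

lemma closedin_M_set:
  assumes "finite_measure P" "nonatomic P"
  shows "closedin (Tc P) (M_set P)"
  unfolding closedin_def topspace_Tc openin_Tc
proof (intro conjI M_set_subset_L0 Tc_openI)
  fix f assume [measurable]: "f \<in> borel_measurable P" and "L0_class P f \<in> L0 P - M_set P"
  then have notM: "L0_class P f \<notin> M_set P"
    by simp
  have "{\<omega> \<in> space P. f \<omega> = 0} \<in> sets P"
    by measurable
  then obtain h :: "'a \<Rightarrow> real" where [measurable]: "h \<in> borel_measurable P"
    and h: "\<And>\<omega>. 0 < h \<omega>"
      "\<And>m. 0 < m \<Longrightarrow> AE \<omega> in P. \<omega> \<in> {\<omega> \<in> space P. f \<omega> = 0} \<longrightarrow> m \<le> h \<omega> \<Longrightarrow>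
        AE \<omega> in P. \<omega> \<notin> {\<omega> \<in> space P. f \<omega> = 0}"
    using nonatomic_positive_not_bounded_below[OF assms] by blast
  \<comment> \<open>Half of |f| alone would vanish where f = 0 and would not be an admissible
    radius; \<open>h\<close> replaces it there.\<close>
  define e where "e \<omega> = (if f \<omega> = 0 then h \<omega> else \<bar>f \<omega>\<bar> / 2)" for \<omega>
  have "L0_class P g \<notin> M_set P"
    if g: "g \<in> borel_measurable P" and ae: "AE \<omega> in P. \<bar>g \<omega> - f \<omega>\<bar> \<le> e \<omega>" for g
  proof
    assume "L0_class P g \<in> M_set P"
    then obtain m where m: "0 < m" "AE \<omega> in P. m < g \<omega>"
      using g by (auto simp: L0_class_mem_M_set)
    \<comment> \<open>On the zero set the ball condition reads |g| \<le> \<open>h\<close>, so m < g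
      \<le> \<open>h\<close>.\<close>
    have "AE \<omega> in P. \<omega> \<in> {\<omega> \<in> space P. f \<omega> = 0} \<longrightarrow> m \<le> h \<omega>"
      using ae m(2) by eventually_elim (auto simp: e_def)
    then have "AE \<omega> in P. \<omega> \<notin> {\<omega> \<in> space P. f \<omega> = 0}"
      using h(2) m(1) by blast
    \<comment> \<open>Now f is nonzero almost everywhere and the radius is |f|/2. If f < 0, then g
      \<le> f/2 < 0, contrary to g > m. So f > 0 and m < g \<le> 3f/2, giving f > 2m/3 >
      m/2.\<close>
    then have "AE \<omega> in P. m / 2 < f \<omega>"
      using ae m(2) AE_space
    proof eventually_elim
      case (elim \<omega>)
      then have "\<bar>g \<omega> - f \<omega>\<bar> \<le> \<bar>f \<omega>\<bar> / 2"
        by (simp add: e_def)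
      with elim m(1) show ?case
        by (simp add: abs_if split: if_splits)
    qed
    then have "L0_class P f \<in> M_set P"
      using m(1) by (subst L0_class_mem_M_set) (auto intro!: exI[of _ "m / 2"])
    with notM show False ..
  qed
  moreover have "e \<in> borel_measurable P"
    unfolding e_def by measurable
  moreover have "0 < e \<omega>" for \<omega>
    by (simp add: e_def h)
  ultimately show "\<exists>e\<in>borel_measurable P. (AE \<omega> in P. 0 < e \<omega>) \<and>
      (\<forall>g\<in>borel_measurable P. (AE \<omega> in P. \<bar>g \<omega> - f \<omega>\<bar> \<le> e \<omega>) \<longrightarrow>
        L0_class P g \<in> L0 P - M_set P)"
    by (intro bexI[of _ e]) (auto simp: L0_class_in_L0)
qed auto

theorem claim3p3:
  fixes P :: "'a measure"
  assumes "prob_space P" and "nonatomic P"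
  shows "L0_convex P (M_set P) \<and> closedin (Tc P) (M_set P) \<and> openin (Tc P) (M_set P)"
proof -
  interpret prob_space P by fact
  show ?thesis
    using L0_convex_M_set closedin_M_set[OF finite_measure_axioms assms(2)] openin_M_set by blast
qed

end
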